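(* Consider the problem $\min_{x\in\mathbb{R}^n}\Phi(x)$, $\Phi(x):=\Psi(x)+\mathcal{X}(x)$, $\Psi=f+h$, where $f$ is differentiable with $L_f$-Lipschitz gradient (possibly nonconvex), $h$ is convex and differentiable with $L_h$-Lipschitz gradient, $L_\Psi=L_f+L_h$, and $\mathcal{X}$ is a proper closed convex (possibly nonsmooth) function with bounded domain. Let $$\mathcal{P}(x,y,c):=\operatorname{argmin}_{u}\Big\{\langle y,u\rangle+\frac{1}{2c}\|u-x\|^2+\mathcal{X}(u)\Big\},\qquad\mathcal{G}(x,y,c):=\frac{1}{c}[x-\mathcal{P}(x,y,c)],$$ and assume there is a constant $M$ with $\|\mathcal{P}(x,y,c)\|\le M$ for all $c>0$, $x,y\in\mathbb{R}^n$. Consider the composite AG method: given $x_0$, $\{\alpha_k\}$ with $\alpha_1=1$, $\alpha_k\in(0,1)$ for $k\ge2$, $\{\beta_k>0\}$, $\{\lambda_k>0\}$, set $x^{ag}_0=x_0$ and for $k\ge1$ $$x^{md}_k=(1-\alpha_k)x^{ag}_{k-1}+\alpha_kx_{k-1},\quad x_k=\mathcal{P}(x_{k-1},\nabla\Psi(x^{md}_k),\lambda_k),\quad x^{ag}_k=\mathcal{P}(x^{md}_k,\nabla\Psi(x^{md}_k),\beta_k).$$ Let $\Gamma_1=1$, $\Gamma_k=(1-\alpha_k)\Gamma_{k-1}$ ($k\ge2$). Suppose $\alpha_k\lambda_k\le\beta_k<1/L_\Psi$ for all $k$, $\frac{\alpha_1}{\lambda_1\Gamma_1}\ge\frac{\alpha_2}{\lambda_2\Gamma_2}\ge\cdots$,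 and that an optimal solution $x^*$ of $\min\Phi$ exists. Then for any $N\ge1$, $$\min_{k=1,\ldots,N}\|\mathcal{G}(x^{md}_k,\nabla\Psi(x^{md}_k),\beta_k)\|^2\le2\Big[\sum_{k=1}^N\Gamma_k^{-1}\beta_k(1-L_\Psi\beta_k)\Big]^{-1}\Big[\frac{\|x_0-x^*\|^2}{2\lambda_1}+\frac{L_f}{\Gamma_N}(\|x^*\|^2+2M^2)\Big].$$ If in addition $L_f=0$, then $\Phi(x^{ag}_N)-\Phi(x^* )\le\frac{\Gamma_N\|x_0-x^*\|^2}{2\lambda_1}$.
   Context: $\|\cdot\|$ is the Euclidean norm. *)

theory Defs
  imports "HOL-Analysis.Analysis"
begin

text \<open>The extended-valued proper closed convex function X is represented by its
  (nonempty) effective domain D together with its (real) values on D;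
  X is taken to be +infinity outside D.\<close>

definition proper_closed_convex :: "'a::real_normed_vector set \<Rightarrow> ('a \<Rightarrow> real) \<Rightarrow> bool" where
  "proper_closed_convex D X \<longleftrightarrow>
     D \<noteq> {} \<and> convex_on D X \<and> closed {(x, t). x \<in> D \<and> X x \<le> t}"

text \<open>Prox mapping: P(x,y,c) = argmin_u { <y,u> + |u-x|^2/(2c) + X(u) }.
  The minimization is over the domain D of X (outside D the objective is +infinity).\<close>

definition prox_obj :: "('a::real_inner \<Rightarrow> real) \<Rightarrow> 'a \<Rightarrow> 'a \<Rightarrow> real \<Rightarrow> 'a \<Rightarrow> real" where
  "prox_obj X x y c u = inner y u + (norm (u - x))\<^sup>2 / (2 * c) + X u"

definition prox :: "'a::real_inner set \<Rightarrow> ('a \<Rightarrow> real) \<Rightarrow> 'a \<Rightarrow> 'a \<Rightarrow> real \<Rightarrow> 'a" where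
  "prox D X x y c = (SOME u. u \<in> D \<and> (\<forall>v\<in>D. prox_obj X x y c u \<le> prox_obj X x y c v))"

definition grad_map :: "'a::real_inner set \<Rightarrow> ('a \<Rightarrow> real) \<Rightarrow> 'a \<Rightarrow> 'a \<Rightarrow> real \<Rightarrow> 'a" where
  "grad_map D X x y c = (1 / c) *\<^sub>R (x - prox D X x y c)"

text \<open>Gamma_1 = 1, Gamma_k = (1 - alpha_k) Gamma_{k-1} for k >= 2 (Gamma_0 is unused).\<close>

fun Gamma :: "(nat \<Rightarrow> real) \<Rightarrow> nat \<Rightarrow> real" where
  "Gamma \<alpha> 0 = 1"
| "Gamma \<alpha> (Suc k) = (if k = 0 then 1 else (1 - \<alpha> (Suc k)) * Gamma \<alpha> k)"

end

theory Submission
  imports Defs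
begin

text \<open>Adding the prox inequalities of the two sequences at each step and telescoping with the
  weights 1/Gamma bounds the weighted sum of squared gradient mappings. The starting point
  \<open>x 0\<close> need not lie in the domain, so \<open>norm (x 0) \<le> M\<close> may fail and the usual estimate of the
  nonconvexity error at \<open>k = 1\<close> is not available. Two things replace it. A bound of
  \<open>f p - f q - inner (gf z) (p - q)\<close> that is linear in the distance of \<open>p\<close> and \<open>q\<close> controls the
  error at \<open>k = 1\<close> by the distances between \<open>x 0\<close>, \<open>xag 1\<close> and \<open>xs\<close>. For \<open>k \<ge> 2\<close>, the
  boundedness of the iterates yields a second estimate in which the squared gradient mappings count
  twice, at the price of a term linear in them. The first
  estimate suffices when \<open>norm (x 0 - xs)\<close> is not much larger than \<open>norm (x 0 - xag 1)\<close>, the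
  second one otherwise. The bound \<open>norm xs \<le> M\<close> holds because a minimizer is a fixed point of its
  own prox step.\<close>

section \<open>Existence of prox points and the three-point inequality\<close>

text \<open>\<open>X\<close> is only lower semicontinuous and \<open>D\<close> need not be closed,
  so attainment for continuous functions on compact sets does not apply. Each sublevel set
  \<open>K r\<close> is closed as the preimage of the epigraph under a continuous map. Boundedness
  of \<open>D\<close> makes it compact, and the finite intersection property yields a common
  point.\<close>

lemma closed_epigraph_attains_inf:
  fixes X \<phi> :: "'a::euclidean_space \<Rightarrow> real"
  assumes D: "D \<noteq> {}" "bounded D"
    and epi: "closed {(x, t). x \<in> D \<and> X x \<le> t}"
    and \<phi>: "continuous_on UNIV \<phi>"
  shows "\<exists>u\<in>D. \<forall>v\<in>D. \<phi> u + X u \<le> \<phi> v + X v"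
proof -
  define K where "K r = {x \<in> D. \<phi> x + X x \<le> r}" for r
  have closed_K: "closed (K r)" for r
  proof -
    have "K r = (\<lambda>x. (x, r - \<phi> x)) -` {(x, t). x \<in> D \<and> X x \<le> t}"
      by (auto simp: K_def)
    then show ?thesis
      using continuous_closed_vimage[OF epi, of "\<lambda>x. (x, r - \<phi> x)"] \<phi>
      by (simp add: continuous_on_eq_continuous_at continuous_Pair continuous_diff)
  qed
  obtain v0 where v0: "v0 \<in> D" using D by auto
  let ?r0 = "\<phi> v0 + X v0"
  have comp: "compact (K ?r0)"
    using closed_K D(2) by (auto simp: compact_eq_bounded_closed K_def intro: bounded_subset)
  have "K ?r0 \<inter> \<Inter> ((\<lambda>v. K (\<phi> v + X v)) ` D) \<noteq> {}"
  proof (rule compact_imp_fip_image[OF comp])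
    fix I' assume I': "finite I'" "I' \<subseteq> D"
    have "\<exists>u\<in>insert v0 I'. \<forall>v\<in>insert v0 I'. \<phi> u + X u \<le> \<phi> v + X v"
      using I' ex_is_arg_min_if_finite[of "insert v0 I'" "\<lambda>u. \<phi> u + X u"]
      by (force simp: is_arg_min_linorder)
    then obtain u where "u \<in> insert v0 I'" "\<forall>v\<in>insert v0 I'. \<phi> u + X u \<le> \<phi> v + X v"
      by blast
    then have "u \<in> K ?r0 \<inter> (\<Inter>v\<in>I'. K (\<phi> v + X v))"
      using I' v0 by (auto simp: K_def)
    then show "K ?r0 \<inter> (\<Inter>v\<in>I'. K (\<phi> v + X v)) \<noteq> {}" by blast
  qed (use closed_K in auto)
  then obtain u where "u \<in> K ?r0" "\<forall>v\<in>D. u \<in> K (\<phi> v + X v)" by blast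
  then show ?thesis by (auto simp: K_def)
qed

text \<open>Divide by \<open>s\<close> and let \<open>s\<close> tend to 0 from the right. This
  extracts first-order optimality conditions from comparisons along a segment.\<close>

lemma linear_coeff_nonneg:
  fixes A B :: real
  assumes "\<And>s. 0 < s \<Longrightarrow> s \<le> 1 \<Longrightarrow> 0 \<le> s * A + s\<^sup>2 * B"
  shows "0 \<le> A"
proof (rule tendsto_lowerbound)
  show "((\<lambda>s. A + s * B) \<longlongrightarrow> A) (at_right 0)"
    by (auto intro!: tendsto_eq_intros)
  have "0 \<le> A + s * B" if "0 < s" "s < 1" for s
  proof -
    have "0 \<le> s * (A + s * B)"
      using assms[of s] that by (simp add: power2_eq_square algebra_simps)
    then show ?thesis using that by (simp add: zero_le_mult_iff)
  qed
  then show "\<forall>\<^sub>F s in at_right 0. 0 \<le> A + s * B"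
    using eventually_at_right[of 0 "1::real"] by (auto intro!: exI[of _ 1])
qed simp

text \<open>Makes the \<open>SOME\<close> in \<open>prox\<close> meaningful. Attainment rests on
  boundedness of \<open>D\<close>, so every real \<open>c\<close> is covered.\<close>

lemma prox_in_domain_minimal:
  fixes X :: "'a::euclidean_space \<Rightarrow> real"
  assumes "proper_closed_convex D X" "bounded D"
  shows "prox D X x y c \<in> D"
    and "v \<in> D \<Longrightarrow> prox_obj X x y c (prox D X x y c) \<le> prox_obj X x y c v"
proof -
  define \<phi> where "\<phi> u = inner y u + (norm (u - x))\<^sup>2 / (2 * c)" for u
  have "continuous_on UNIV \<phi>"
    \<comment> \<open>As a product with the constant \<open>inverse (2 * c)\<close> the quotient is
      continuous without a side condition on \<open>c\<close>; for \<open>c = 0\<close> this factor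
      is 0.\<close>
    unfolding \<phi>_def divide_inverse by (intro continuous_intros)
  then have "\<exists>u\<in>D. \<forall>v\<in>D. \<phi> u + X u \<le> \<phi> v + X v"
    using assms closed_epigraph_attains_inf[of D X \<phi>] unfolding proper_closed_convex_def by blast
  moreover have "prox_obj X x y c u = \<phi> u + X u" for u
    by (simp add: prox_obj_def \<phi>_def)
  ultimately have "\<exists>u. u \<in> D \<and> (\<forall>v\<in>D. prox_obj X x y c u \<le> prox_obj X x y c v)"
    by auto
  from someI_ex[OF this, folded prox_def]
  show "prox D X x y c \<in> D"
    and "v \<in> D \<Longrightarrow> prox_obj X x y c (prox D X x y c) \<le> prox_obj X x y c v"
    by auto
qed

text \<open>Comparing \<open>u\<close> with points on the segment towards \<open>v\<close> gives the
  variational inequality at \<open>u\<close>; polarization turns its inner product into three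
  squared distances.\<close>

lemma prox_three_point:
  fixes X :: "'a::euclidean_space \<Rightarrow> real"
  assumes X: "proper_closed_convex D X" "bounded D" and c: "0 < c" and v: "v \<in> D"
    and u: "u = prox D X x y c"
  shows "inner y (u - v) + X u - X v
    \<le> ((norm (x - v))\<^sup>2 - (norm (u - v))\<^sup>2 - (norm (x - u))\<^sup>2) / (2 * c)"
proof -
  have cv: "convex_on D X" using X by (simp add: proper_closed_convex_def)
  have uD: "u \<in> D" using prox_in_domain_minimal(1)[OF X] u by simp
  have "0 \<le> inner y (v - u) + X v - X u + inner (u - x) (v - u) / c"
  proof (rule linear_coeff_nonneg)
    fix s :: real assume s: "0 < s" "s \<le> 1"
    let ?w = "(1 - s) *\<^sub>R u + s *\<^sub>R v"
    have wD: "?w \<in> D"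
      using cv uD v s by (auto simp: convex_on_def convex_alt)
    have Xw: "X ?w \<le> (1 - s) * X u + s * X v"
      using convex_onD[OF cv, of s u v] uD v s by simp
    have obj: "prox_obj X x y c u \<le> prox_obj X x y c ?w"
      using prox_in_domain_minimal(2)[OF X wD] u by simp
    have w: "?w - x = (u - x) + s *\<^sub>R (v - u)"
      by (simp add: algebra_simps)
    have nw: "(norm (?w - x))\<^sup>2 = (norm (u - x))\<^sup>2 + 2 * s * inner (u - x) (v - u)
        + s\<^sup>2 * (norm (v - u))\<^sup>2"
      unfolding w power2_norm_eq_inner
      by (simp add: inner_add_left inner_add_right inner_commute power2_eq_square)
    have "inner y ?w = inner y u + s * inner y (v - u)"
      by (simp add: inner_add_right inner_diff_right algebra_simps)
    then have "0 \<le> s * inner y (v - u) + (2 * s * inner (u - x) (v - u)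
        + s\<^sup>2 * (norm (v - u))\<^sup>2) / (2 * c) + (s * X v - s * X u)"
      using obj Xw unfolding prox_obj_def nw add_divide_distrib left_diff_distrib by linarith
    also have "\<dots> = s * (inner y (v - u) + X v - X u + inner (u - x) (v - u) / c)
        + s\<^sup>2 * ((norm (v - u))\<^sup>2 / (2 * c))"
      using c by (simp add: field_simps)
    finally show "0 \<le> \<dots>" .
  qed
  moreover have "inner (u - x) (v - u)
      = ((norm (x - v))\<^sup>2 - (norm (u - v))\<^sup>2 - (norm (x - u))\<^sup>2) / 2"
    by (simp add: power2_norm_eq_inner inner_diff_left inner_diff_right inner_commute)
  ultimately show ?thesis
    using c by (simp add: inner_diff_right field_simps)
qed

section \<open>First-order bounds for smooth and convex functions\<close>

lemma has_real_derivative_along_line: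
  fixes f :: "'a::real_inner \<Rightarrow> real"
  assumes "\<And>z. (f has_derivative (\<lambda>v. inner (gf z) v)) (at z)"
  shows "((\<lambda>s. f (q + s *\<^sub>R d)) has_real_derivative inner (gf (q + s *\<^sub>R d)) d) (at s)"
proof -
  have "((\<lambda>s. q + s *\<^sub>R d) has_derivative (\<lambda>h. h *\<^sub>R d)) (at s)"
    by (auto intro!: derivative_eq_intros)
  from has_derivative_compose[OF this assms]
  show ?thesis
    by (simp add: has_field_derivative_def mult_commute_abs)
qed

text \<open>The choices \<open>z = q\<close> and \<open>z = p\<close> give the usual quadratic upper and lower bounds.\<close>

lemma lipschitz_gradient_bound:
  fixes f :: "'a::real_inner \<Rightarrow> real"
  assumes df: "\<And>z. (f has_derivative (\<lambda>v. inner (gf z) v)) (at z)"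
    and lip: "L-lipschitz_on UNIV gf"
  shows "f p - f q - inner (gf z) (p - q) \<le> L * norm (p - q) * (norm (p - z) + norm (q - z)) / 2"
proof -
  have L: "0 \<le> L" using lip by (rule lipschitz_on_nonneg)
  define a b where "a = norm (q - z)" and "b = norm (p - z)"
  \<comment> \<open>The point at parameter \<open>t\<close> of the segment lies within
    \<open>(1 - t) * a + t * b\<close> of \<open>z\<close>. The last term is
    \<open>L * norm (p - q)\<close> times the integral of this bound from 0 to \<open>s\<close>, so
    that \<open>\<psi>\<close> is nonincreasing.\<close>
  define \<psi> where "\<psi> s = f (q + s *\<^sub>R (p - q)) - s * inner (gf z) (p - q)
      - L * norm (p - q) * (s * a + s\<^sup>2 * (b - a) / 2)" for s
  have "\<psi> 1 \<le> \<psi> 0"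
  proof (rule DERIV_nonpos_imp_nonincreasing[of 0 1])
    fix s :: real assume s: "0 \<le> s" "s \<le> 1"
    let ?w = "q + s *\<^sub>R (p - q)"
    let ?d = "inner (gf ?w) (p - q) - inner (gf z) (p - q) - L * norm (p - q) * (a + s * (b - a))"
    have "(\<psi> has_real_derivative ?d) (at s)"
      unfolding \<psi>_def
      by (auto intro!: derivative_eq_intros has_real_derivative_along_line[where gf = gf] df)
    moreover have "?d \<le> 0"
    proof -
      have "?w - z = (1 - s) *\<^sub>R (q - z) + s *\<^sub>R (p - z)"
        by (simp add: algebra_simps)
      then have "norm (?w - z) \<le> (1 - s) * a + s * b"
        using s norm_triangle_ineq[of "(1 - s) *\<^sub>R (q - z)" "s *\<^sub>R (p - z)"]
        by (simp add: a_def b_def)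
      then have "L * norm (?w - z) \<le> L * ((1 - s) * a + s * b)"
        using L by (rule mult_left_mono)
      then have "norm (gf ?w - gf z) \<le> L * ((1 - s) * a + s * b)"
        using lipschitz_onD[OF lip UNIV_I UNIV_I, of ?w z] unfolding dist_norm by linarith
      then have "norm (gf ?w - gf z) * norm (p - q) \<le> L * ((1 - s) * a + s * b) * norm (p - q)"
        by (rule mult_right_mono) simp
      moreover have "inner (gf ?w) (p - q) - inner (gf z) (p - q)
          \<le> norm (gf ?w - gf z) * norm (p - q)"
        using norm_cauchy_schwarz[of "gf ?w - gf z" "p - q"] by (simp add: inner_diff_left)
      ultimately show ?thesis by (simp add: algebra_simps)
    qed
    ultimately show "\<exists>y. (\<psi> has_real_derivative y) (at s) \<and> y \<le> 0" by blast
  qed simp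
  then show ?thesis by (simp add: \<psi>_def a_def b_def field_simps)
qed

text \<open>By convexity every difference quotient along the segment from \<open>z\<close> to
  \<open>v\<close> is at most \<open>h v - h z\<close>; pass to the limit.\<close>

lemma convex_gradient_ineq:
  fixes h :: "'a::real_inner \<Rightarrow> real"
  assumes cv: "convex_on UNIV h"
    and dh: "\<And>z. (h has_derivative (\<lambda>v. inner (gh z) v)) (at z)"
  shows "h z + inner (gh z) (v - z) \<le> h v"
proof -
  let ?\<phi> = "\<lambda>s. h (z + s *\<^sub>R (v - z))"
  have "((\<lambda>s. (?\<phi> s - ?\<phi> 0) / s) \<longlongrightarrow> inner (gh z) (v - z)) (at 0)"
    using has_real_derivative_along_line[OF dh, of z "v - z" 0] by (simp add: DERIV_def)
  then have lim: "((\<lambda>s. (?\<phi> s - ?\<phi> 0) / s) \<longlongrightarrow> inner (gh z) (v - z)) (at_right 0)"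
    by (simp add: filterlim_at_split)
  have "(?\<phi> s - ?\<phi> 0) / s \<le> h v - h z" if "0 < s" "s < 1" for s
  proof -
    have "z + s *\<^sub>R (v - z) = (1 - s) *\<^sub>R z + s *\<^sub>R v" by (simp add: algebra_simps)
    then have "?\<phi> s \<le> (1 - s) * h z + s * h v"
      using convex_onD[OF cv, of s z v] that by simp
    then show ?thesis using that by (simp add: field_simps)
  qed
  then have "\<forall>\<^sub>F s in at_right 0. (?\<phi> s - ?\<phi> 0) / s \<le> h v - h z"
    using eventually_at_right[of 0 "1::real"] by (auto intro!: exI[of _ 1])
  then have "inner (gh z) (v - z) \<le> h v - h z"
    by (rule tendsto_upperbound[OF lim]) simp
  then show ?thesis by simp
qed

text \<open>Minimality tested on the segment towards the prox point \<open>u\<close> makes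
  \<open>inner (gF z) (u - z) + X u - X z\<close> nonnegative, while the three-point inequality
  bounds it above by minus \<open>(norm (u - z))\<^sup>2 / c\<close>. \<open>F\<close> may be
  nonconvex: its Lipschitz gradient leaves an error quadratic in \<open>s\<close>.\<close>

lemma minimizer_prox_fixed:
  fixes X F :: "'a::euclidean_space \<Rightarrow> real"
  assumes X: "proper_closed_convex D X" "bounded D" and c: "0 < c" and z: "z \<in> D"
    and dF: "\<And>w. (F has_derivative (\<lambda>v. inner (gF w) v)) (at w)"
    and lip: "L-lipschitz_on UNIV gF"
    and opt: "\<And>w. w \<in> D \<Longrightarrow> F z + X z \<le> F w + X w"
  shows "prox D X z (gF z) c = z"
proof -
  have cv: "convex_on D X" using X by (simp add: proper_closed_convex_def)
  define u where "u = prox D X z (gF z) c"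
  have u: "u \<in> D" unfolding u_def by (rule prox_in_domain_minimal[OF X])
  have "0 \<le> inner (gF z) (u - z) + X u - X z"
  proof (rule linear_coeff_nonneg)
    fix s :: real assume s: "0 < s" "s \<le> 1"
    let ?w = "(1 - s) *\<^sub>R z + s *\<^sub>R u"
    have wD: "?w \<in> D"
      using cv u z s by (auto simp: convex_on_def convex_alt)
    have Xw: "X ?w \<le> (1 - s) * X z + s * X u"
      using convex_onD[OF cv, of s z u] u z s by simp
    have w: "?w - z = s *\<^sub>R (u - z)" by (simp add: algebra_simps)
    have "F ?w - F z \<le> s * inner (gF z) (u - z) + L * s\<^sup>2 * (norm (u - z))\<^sup>2 / 2"
      using lipschitz_gradient_bound[OF dF lip, of ?w z z] s
      unfolding w by (simp add: power2_eq_square mult_ac)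
    then show "0 \<le> s * (inner (gF z) (u - z) + X u - X z) + s\<^sup>2 * (L * (norm (u - z))\<^sup>2 / 2)"
      using Xw opt[OF wD] by (simp add: algebra_simps)
  qed
  moreover have "inner (gF z) (u - z) + X u - X z
      \<le> (0 - (norm (u - z))\<^sup>2 - (norm (u - z))\<^sup>2) / (2 * c)"
    using prox_three_point[OF X c z u_def] by (simp add: norm_minus_commute)
  ultimately have "0 \<le> (0 - (norm (u - z))\<^sup>2 - (norm (u - z))\<^sup>2) / (2 * c)" by linarith
  then have "(norm (u - z))\<^sup>2 \<le> 0" using c by (simp add: divide_le_0_iff zero_le_divide_iff)
  then show ?thesis by (simp add: u_def)
qed

section \<open>Scalar estimates and the Gamma weights\<close>

text \<open>\<open>G\<close> stands for the norm of a gradient mapping, \<open>\<delta>\<close> for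
  the length of a step of \<open>x\<close>, \<open>m\<close> for the least such norm. The first
  bound completes the square in \<open>\<delta>\<close>. The second drops the
  \<open>\<delta>\<^sup>2\<close> term and bounds \<open>\<delta>\<close> by \<open>K\<close>, which
  doubles the coefficient of \<open>m\<^sup>2\<close> at a cost linear in \<open>m\<close>.\<close>

lemma quadratic_lower_bounds:
  fixes \<alpha> \<beta> l L m G \<delta> K :: real
  assumes "0 \<le> \<alpha>" "0 < l" "\<alpha> * l \<le> \<beta>" "0 \<le> L" "L * \<beta> < 1" "0 \<le> m" "m \<le> G" "0 \<le> \<delta>" "\<delta> \<le> K"
  defines "F \<equiv> (2 - L * \<beta>) * \<beta> * G\<^sup>2 / 2 - \<alpha> * G * \<delta> + \<alpha> / (2 * l) * \<delta>\<^sup>2"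
  shows "\<beta> * (1 - L * \<beta>) * m\<^sup>2 / 2 \<le> F"
    and "\<beta> * (1 - L * \<beta>) * m\<^sup>2 - \<alpha> * K * m \<le> F"
proof -
  have \<beta>: "0 \<le> \<beta>" using assms by (meson mult_nonneg_nonneg less_imp_le order_trans)
  have G: "0 \<le> G" using assms by simp
  define w where "w = \<beta> * (1 - L * \<beta>)"
  have w: "0 \<le> w" "w \<le> \<beta>"
    using \<beta> assms(4,5) by (auto simp: w_def intro: mult_left_le)
  have wm: "w * m\<^sup>2 \<le> w * G\<^sup>2" "\<beta> * m\<^sup>2 \<ge> w * m\<^sup>2"
    using w assms by (auto intro!: mult_left_mono mult_right_mono power_mono)
  have F: "F = w * G\<^sup>2 / 2 + \<beta> * G\<^sup>2 / 2 - \<alpha> * G * \<delta> + \<alpha> / (2 * l) * \<delta>\<^sup>2"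
    by (simp add: F_def w_def field_simps)
  have "0 \<le> \<alpha> / (2 * l) * (\<delta> - l * G)\<^sup>2" using assms by simp
  also have "\<dots> = \<alpha> / (2 * l) * \<delta>\<^sup>2 - \<alpha> * G * \<delta> + (\<alpha> * l) * G\<^sup>2 / 2"
    using \<open>0 < l\<close> by (simp add: power2_eq_square field_simps)
  also have "(\<alpha> * l) * G\<^sup>2 / 2 \<le> \<beta> * G\<^sup>2 / 2"
    using assms by (simp add: mult_right_mono)
  finally have F1: "w * G\<^sup>2 / 2 \<le> F" unfolding F by simp
  show 1: "\<beta> * (1 - L * \<beta>) * m\<^sup>2 / 2 \<le> F"
    using F1 wm unfolding w_def[symmetric] by simp
  have "\<alpha> * G * \<delta> \<le> \<alpha> * G * K" using assms G by (simp add: mult_left_mono)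
  moreover have "0 \<le> \<alpha> / (2 * l) * \<delta>\<^sup>2" using assms by simp
  ultimately have F2: "w * G\<^sup>2 / 2 + G * (\<beta> * G / 2 - \<alpha> * K) \<le> F"
    unfolding F by (simp add: power2_eq_square algebra_simps)
  have "w * m\<^sup>2 / 2 + m * (\<beta> * m / 2 - \<alpha> * K) \<le> F"
  \<comment> \<open>The left side need not be monotone in \<open>m\<close>. A nonpositive bracket is
    discarded and the completed square suffices; with a positive bracket the product grows when
    \<open>m\<close> is replaced by \<open>G\<close>.\<close>
  proof (cases "\<beta> * m / 2 \<le> \<alpha> * K")
    case True
    then have "m * (\<beta> * m / 2 - \<alpha> * K) \<le> 0" using assms by (simp add: mult_nonneg_nonpos)
    then show ?thesis using F1 wm by simp
  next
    case False
    have "\<beta> * m / 2 - \<alpha> * K \<le> \<beta> * G / 2 - \<alpha> * K" using \<beta> assms by (simp add: mult_left_mono)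
    then have "m * (\<beta> * m / 2 - \<alpha> * K) \<le> G * (\<beta> * G / 2 - \<alpha> * K)"
      using False G assms by (intro mult_mono) auto
    then show ?thesis using F2 wm by simp
  qed
  then show "\<beta> * (1 - L * \<beta>) * m\<^sup>2 - \<alpha> * K * m \<le> F"
    using wm unfolding w_def[symmetric] by (simp add: power2_eq_square algebra_simps)
qed

lemma Gamma_pos:
  assumes "\<And>k. 2 \<le> k \<Longrightarrow> \<alpha> k < 1"
  shows "0 < Gamma \<alpha> n"
proof (induction n)
  case (Suc n)
  then show ?case using assms[of "Suc n"] by auto
qed simp

text \<open>Dividing a step by \<open>Gamma \<alpha> (Suc k)\<close> absorbs the factor
  \<open>1 - \<alpha> (Suc k)\<close> and turns the coefficient of \<open>C\<close> into a
  difference of reciprocals of Gamma; \<open>mono\<close> lets the distances telescope. The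
  recursion is assumed only from the second step on, the first one entering through
  \<open>E 1\<close> and \<open>d 1\<close>.\<close>

lemma Gamma_telescope:
  fixes E d c \<alpha> l :: "nat \<Rightarrow> real"
  assumes N: "1 \<le> N" and alpha1: "\<alpha> 1 = 1"
    and alpha: "\<And>k. 2 \<le> k \<Longrightarrow> \<alpha> k < 1"
    and mono: "\<And>k. 1 \<le> k \<Longrightarrow>
       \<alpha> (k + 1) / (l (k + 1) * Gamma \<alpha> (k + 1)) \<le> \<alpha> k / (l k * Gamma \<alpha> k)"
    and d: "\<And>k. 0 \<le> d k"
    and step: "\<And>k. 1 \<le> k \<Longrightarrow> Suc k \<le> N \<Longrightarrow> E (Suc k) + c (Suc k) \<le> (1 - \<alpha> (Suc k)) * E k
        + \<alpha> (Suc k) / (2 * l (Suc k)) * (d k - d (Suc k)) + \<alpha> (Suc k) * C"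
  shows "E N / Gamma \<alpha> N + (\<Sum>k = 2..N. c k / Gamma \<alpha> k) + \<alpha> N / (l N * Gamma \<alpha> N) * d N / 2
    \<le> E 1 + d 1 / (2 * l 1) + (1 / Gamma \<alpha> N - 1) * C"
  using N step
proof (induction N rule: nat_induct_at_least)
  case base
  then show ?case using alpha1 by simp
next
  case (Suc n)
  define g g' a' where "g = Gamma \<alpha> n" and "g' = Gamma \<alpha> (Suc n)" and "a' = \<alpha> (Suc n)"
  have g: "0 < g" and a': "a' < 1"
    using Gamma_pos[of \<alpha>] alpha Suc.hyps by (auto simp: g_def a'_def)
  have g': "g' = (1 - a') * g"
    using Suc.hyps by (simp add: g'_def g_def a'_def)
  have g'0: "0 < g'" using g a' by (simp add: g')
  define \<kappa> where "\<kappa> = a' / (l (Suc n) * g')"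
  have "\<kappa> \<le> \<alpha> n / (l n * g)"
    using mono[of n] Suc.hyps by (simp add: \<kappa>_def g'_def g_def a'_def)
  then have \<kappa>: "\<kappa> * d n / 2 \<le> \<alpha> n / (l n * g) * d n / 2"
    using mult_right_mono[OF _ d] by fastforce
  have IH: "E n / g + (\<Sum>k = 2..n. c k / Gamma \<alpha> k) + \<alpha> n / (l n * g) * d n / 2
    \<le> E 1 + d 1 / (2 * l 1) + (1 / g - 1) * C"
    unfolding g_def using Suc by simp
  have "(E (Suc n) + c (Suc n)) / g' \<le> ((1 - a') * E n
        + a' / (2 * l (Suc n)) * (d n - d (Suc n)) + a' * C) / g'"
    using Suc.prems[of n] Suc.hyps g'0 by (simp add: a'_def divide_right_mono)
  also have "\<dots> = (1 - a') * E n / g' + \<kappa> * d n / 2 - \<kappa> * d (Suc n) / 2 + a' / g' * C"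
    by (simp add: \<kappa>_def diff_divide_distrib add_divide_distrib right_diff_distrib)
  also have "(1 - a') * E n / g' = E n / g" using a' by (simp add: g')
  also have "a' / g' = 1 / g' - 1 / g" using g a' by (simp add: g' field_simps)
  finally have "(E (Suc n) + c (Suc n)) / g' \<le> E n / g + \<kappa> * d n / 2 - \<kappa> * d (Suc n) / 2
      + (1 / g' - 1 / g) * C" .
  moreover have "(\<Sum>k = 2..Suc n. c k / Gamma \<alpha> k) = (\<Sum>k = 2..n. c k / Gamma \<alpha> k) + c (Suc n) / g'"
    using Suc.hyps by (simp add: g'_def)
  ultimately show ?case
    using IH \<kappa> unfolding g'_def[symmetric] a'_def[symmetric] \<kappa>_def[symmetric] add_divide_distrib
      left_diff_distrib
    by linarith
qed

text \<open>With \<open>m\<close> the least norm of a gradient mapping: \<open>a\<close>, \<open>b\<close>, \<open>e\<close> are the distances between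
  \<open>x 0\<close>, \<open>xag 1\<close> and \<open>xs\<close>, \<open>s = norm xs\<close>, \<open>\<tau> = 1 / Gamma \<alpha> N - 1\<close>, \<open>\<gamma>\<close> is the share of
  the first step in the weighted sum and \<open>q\<close> that of the later ones.\<close>

lemma weighted_sum_bound:
  fixes a b e s M l \<beta> Lf \<tau> m q \<gamma> V :: real
  assumes M: "0 \<le> s" "s \<le> M" and e: "0 \<le> e" "e \<le> M + s" and b: "0 \<le> b" and a: "0 \<le> a" "a \<le> b + e"
    and l: "0 < l" "l \<le> \<beta>" and Lf: "0 \<le> Lf" and \<tau>: "0 \<le> \<tau>" and m: "\<beta> * m \<le> b"
    and \<gamma>: "\<gamma> \<le> (1 - Lf * \<beta>) * b\<^sup>2 / (2 * \<beta>)"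
    and first: "V + \<gamma> \<le> a\<^sup>2 / (2 * l) + Lf * (e * (a + b) / 2 - b\<^sup>2 / 2)"
    and std: "q \<le> V + Lf * \<tau> * (M + s)\<^sup>2 / 2"
    and alt: "2 * q - 2 * M * \<tau> * m \<le> V + Lf * \<tau> * (M + s)\<^sup>2 / 2"
  shows "q + \<gamma> \<le> a\<^sup>2 / (2 * l) + Lf * (1 + \<tau>) * (s\<^sup>2 + 2 * M\<^sup>2)"
proof -
  define R where "R = e * (a + b) / 2 - b\<^sup>2 / 2"
  have \<beta>: "0 < \<beta>" using l by simp
  have M0: "0 \<le> M" using M by simp
  have e2: "e\<^sup>2 \<le> (M + s)\<^sup>2" using e by (simp add: power_mono)
  have Ms: "(M + s)\<^sup>2 \<le> 2 * M\<^sup>2 + 2 * s\<^sup>2"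
    using sum_squares_bound[of M s] by (simp add: power2_sum)
  have "R \<le> e * (2 * b + e) / 2 - b\<^sup>2 / 2"
    using a e by (auto simp: R_def intro!: mult_left_mono)
  also have "\<dots> \<le> e\<^sup>2"
    using zero_le_power2[of "e - b"] by (simp add: power2_eq_square algebra_simps)
  finally have Re: "R \<le> e\<^sup>2" .
  show ?thesis
  \<comment> \<open>The threshold is what \<open>alt\<close> costs: bounding \<open>\<gamma>\<close>
    and \<open>2 * M * \<tau> * m\<close> in terms of \<open>b\<close> produces
    \<open>(b\<^sup>2 + 4 * \<tau> * M * b) / (2 * \<beta>)\<close>, which must fit under the second
    copy of \<open>a\<^sup>2 / (2 * l)\<close> in the doubled goal.\<close>
  proof (cases "b\<^sup>2 + 4 * \<tau> * M * b \<le> a\<^sup>2")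
    case True
    have "2 * (q + \<gamma>) \<le> (V + \<gamma>) + \<gamma> + 2 * M * \<tau> * m + Lf * \<tau> * (M + s)\<^sup>2 / 2"
      using alt by simp
    also have "\<dots> \<le> a\<^sup>2 / (2 * l) + Lf * R + (1 - Lf * \<beta>) * b\<^sup>2 / (2 * \<beta>) + 2 * M * \<tau> * (b / \<beta>)
        + Lf * \<tau> * (M + s)\<^sup>2 / 2"
    proof -
      have "m \<le> b / \<beta>" using m \<beta> by (simp add: field_simps)
      then have "2 * M * \<tau> * m \<le> 2 * M * \<tau> * (b / \<beta>)" using M0 \<tau> by (intro mult_left_mono) auto
      then show ?thesis using first \<gamma> unfolding R_def by linarith
    qed
    also have "\<dots> = a\<^sup>2 / (2 * l) + (b\<^sup>2 + 4 * \<tau> * M * b) / (2 * \<beta>)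
        + Lf * (R - b\<^sup>2 / 2 + \<tau> * (M + s)\<^sup>2 / 2)"
      using \<beta> by (simp add: field_simps)
    also have "\<dots> \<le> a\<^sup>2 / (2 * l) + a\<^sup>2 / (2 * l) + Lf * (2 * (1 + \<tau>) * (s\<^sup>2 + 2 * M\<^sup>2))"
    proof -
      have "(b\<^sup>2 + 4 * \<tau> * M * b) / (2 * \<beta>) \<le> a\<^sup>2 / (2 * l)"
        using True l by (intro frac_le) auto
      moreover have "R - b\<^sup>2 / 2 + \<tau> * (M + s)\<^sup>2 / 2 \<le> 2 * (1 + \<tau>) * (s\<^sup>2 + 2 * M\<^sup>2)"
      proof -
        have 1: "(M + s)\<^sup>2 \<le> 2 * (s\<^sup>2 + 2 * M\<^sup>2)" by (rule order_trans[OF Ms]) simp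
        then have "\<tau> * ((M + s)\<^sup>2 / 2) \<le> \<tau> * (2 * (s\<^sup>2 + 2 * M\<^sup>2))"
          using \<tau> by (intro mult_left_mono) (auto intro: order_trans[OF 1])
        moreover have "R - b\<^sup>2 / 2 \<le> 2 * (s\<^sup>2 + 2 * M\<^sup>2)" using Re e2 1 zero_le_power2[of b] by linarith
        ultimately show ?thesis by (simp add: algebra_simps)
      qed
      ultimately show ?thesis using Lf by (intro add_mono mult_left_mono) auto
    qed
    finally show ?thesis by (simp add: algebra_simps)
  next
    case False
    have "R \<le> s\<^sup>2 + 2 * M\<^sup>2 + \<tau> * M\<^sup>2"
    \<comment> \<open>For \<open>\<tau> > 1\<close> the term \<open>\<tau> * M\<^sup>2\<close>
      exceeds \<open>M\<^sup>2\<close> and the crude bound \<open>R \<le> e\<^sup>2\<close> is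
      enough. Otherwise the failed threshold yields \<open>a \<le> b + 2 * \<tau> * M\<close> by
      completing the square.\<close>
    proof (cases "\<tau> \<le> 1")
      case True
      have "(b + 2 * \<tau> * M)\<^sup>2 = b\<^sup>2 + 4 * \<tau> * M * b + (2 * \<tau> * M)\<^sup>2"
        by (simp add: power2_sum)
      then have "a\<^sup>2 \<le> (b + 2 * \<tau> * M)\<^sup>2"
        using \<open>\<not> b\<^sup>2 + 4 * \<tau> * M * b \<le> a\<^sup>2\<close> zero_le_power2[of "2 * \<tau> * M"] by linarith
      then have "a \<le> b + 2 * \<tau> * M"
        using b M0 \<tau> by (auto intro: power2_le_imp_le)
      then have "R \<le> e * (2 * b + 2 * \<tau> * M) / 2 - b\<^sup>2 / 2"
        using e by (auto simp: R_def intro!: mult_left_mono)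
      also have "\<dots> \<le> e\<^sup>2 / 2 + e * (\<tau> * M)"
        using zero_le_power2[of "e - b"] by (simp add: power2_eq_square algebra_simps)
      also have "\<dots> \<le> (M + s)\<^sup>2 / 2 + (M + s) * (\<tau> * M)"
        using e2 e \<tau> M0 by (intro add_mono mult_right_mono) auto
      also have "\<dots> \<le> s\<^sup>2 + 2 * M\<^sup>2 + \<tau> * M\<^sup>2"
      proof -
        have "\<tau> * (M * s) \<le> M * s" using True M M0 by (simp add: mult_left_le_one_le \<tau>)
        \<comment> \<open>Once \<open>\<tau> * (M * s)\<close> is replaced by \<open>M * s\<close>,
          the gap between the two sides is half this product.\<close>
        moreover have "0 \<le> (M - s) * (3 * M - s)" using M by (intro mult_nonneg_nonneg) auto
        ultimately show ?thesis by (simp add: power2_eq_square field_simps)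
      qed
      finally show ?thesis .
    next
      case False
      have "M\<^sup>2 \<le> \<tau> * M\<^sup>2" using False mult_right_mono[of 1 \<tau> "M\<^sup>2"] by simp
      moreover have "M * s \<le> M\<^sup>2" using M M0 by (simp add: power2_eq_square mult_left_mono)
      ultimately show ?thesis using Re e2 by (simp add: power2_sum)
    qed
    moreover have "\<tau> * (M + s)\<^sup>2 / 2 + \<tau> * M\<^sup>2 \<le> \<tau> * (s\<^sup>2 + 2 * M\<^sup>2)"
    proof -
      have "(M + s)\<^sup>2 / 2 + M\<^sup>2 \<le> s\<^sup>2 + 2 * M\<^sup>2" using Ms by linarith
      from mult_left_mono[OF this \<tau>] show ?thesis by (simp add: algebra_simps)
    qed
    ultimately have "R + \<tau> * (M + s)\<^sup>2 / 2 \<le> (1 + \<tau>) * (s\<^sup>2 + 2 * M\<^sup>2)"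
      by (simp add: algebra_simps)
    from mult_left_mono[OF this Lf]
    have "Lf * R + Lf * \<tau> * (M + s)\<^sup>2 / 2 \<le> Lf * (1 + \<tau>) * (s\<^sup>2 + 2 * M\<^sup>2)"
      by (simp add: algebra_simps)
    then show ?thesis using first std unfolding R_def by linarith
  qed
qed

section \<open>One iteration of the method\<close>

text \<open>Adds the three-point inequality of \<open>ag\<close> at \<open>v\<close> to
  \<open>\<alpha>\<close> times that of \<open>x\<close> at \<open>z\<close>, where \<open>v\<close>
  is \<open>md\<close> with \<open>xp\<close> replaced by \<open>x\<close>. Then
  \<open>md - v\<close> is a multiple of \<open>x - xp\<close>, which leaves a single cross term.
  The alternative \<open>\<alpha> = 1\<close> serves the first iteration, where \<open>xa\<close>
  may lie outside \<open>D\<close>.\<close>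

lemma prox_pair_ineq:
  fixes X :: "'a::euclidean_space \<Rightarrow> real"
  assumes X: "proper_closed_convex D X" "bounded D" and z: "z \<in> D"
    and \<alpha>: "0 < \<alpha>" "\<alpha> \<le> 1" and pos: "0 < \<beta>" "0 < l"
    and xa: "xa \<in> D \<or> \<alpha> = 1"
    and md: "md = (1 - \<alpha>) *\<^sub>R xa + \<alpha> *\<^sub>R xp"
    and x: "x = prox D X xp g l" and ag: "ag = prox D X md g \<beta>"
  shows "inner g (ag - (1 - \<alpha>) *\<^sub>R xa - \<alpha> *\<^sub>R z) + X ag - (1 - \<alpha>) * X xa - \<alpha> * X z
      + (norm (ag - md))\<^sup>2 / \<beta> - \<alpha> / \<beta> * inner (ag - md) (x - xp)
    \<le> \<alpha> / (2 * l) * ((norm (xp - z))\<^sup>2 - (norm (x - z))\<^sup>2 - (norm (x - xp))\<^sup>2)"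
proof -
  have cv: "convex_on D X" using X by (simp add: proper_closed_convex_def)
  have xD: "x \<in> D" unfolding x by (rule prox_in_domain_minimal[OF X])
  define v where "v = (1 - \<alpha>) *\<^sub>R xa + \<alpha> *\<^sub>R x"
  have v: "v \<in> D" "X v \<le> (1 - \<alpha>) * X xa + \<alpha> * X x"
    using xa xD \<alpha> cv convex_onD[OF cv, of \<alpha> xa x]
    by (auto simp: v_def convex_on_def convex_alt)
  have "inner g (ag - v) + X ag - X v
      \<le> ((norm (md - v))\<^sup>2 - (norm (ag - v))\<^sup>2 - (norm (md - ag))\<^sup>2) / (2 * \<beta>)"
    by (rule prox_three_point[OF X pos(1) v(1) ag])
  also have "\<dots> = \<alpha> / \<beta> * inner (ag - md) (x - xp) - (norm (ag - md))\<^sup>2 / \<beta>"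
  proof -
    have mdv: "md - v = - (\<alpha> *\<^sub>R (x - xp))"
      by (simp add: md v_def algebra_simps)
    have agv: "ag - v = (ag - md) - \<alpha> *\<^sub>R (x - xp)"
      by (simp add: md v_def algebra_simps)
    have "(norm (ag - v))\<^sup>2 = (norm (ag - md))\<^sup>2 - 2 * \<alpha> * inner (ag - md) (x - xp)
        + (norm (md - v))\<^sup>2"
    proof -
      have "(norm (p - \<alpha> *\<^sub>R r))\<^sup>2 = (norm p)\<^sup>2 - 2 * \<alpha> * inner p r + (norm (- (\<alpha> *\<^sub>R r)))\<^sup>2"
        for p r :: 'a
        unfolding norm_minus_cancel power2_norm_eq_inner
        by (simp add: inner_diff_left inner_diff_right inner_commute)
      then show ?thesis unfolding agv mdv .
    qed
    then have "(norm (md - v))\<^sup>2 - (norm (ag - v))\<^sup>2 - (norm (md - ag))\<^sup>2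
        = 2 * (\<alpha> * inner (ag - md) (x - xp) - (norm (ag - md))\<^sup>2)"
      by (simp add: norm_minus_commute[of md ag])
    then show ?thesis by (simp add: diff_divide_distrib)
  qed
  finally have 1: "inner g (ag - v) + X ag - X v
      \<le> \<alpha> / \<beta> * inner (ag - md) (x - xp) - (norm (ag - md))\<^sup>2 / \<beta>" .
  have "\<alpha> * (inner g (x - z) + X x - X z)
      \<le> \<alpha> * (((norm (xp - z))\<^sup>2 - (norm (x - z))\<^sup>2 - (norm (xp - x))\<^sup>2) / (2 * l))"
    using prox_three_point[OF X pos(2) z x] \<alpha> by (intro mult_left_mono) auto
  then have 2: "\<alpha> * inner g (x - z) + \<alpha> * X x - \<alpha> * X z
      \<le> \<alpha> / (2 * l) * ((norm (xp - z))\<^sup>2 - (norm (x - z))\<^sup>2 - (norm (x - xp))\<^sup>2)"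
    by (simp add: norm_minus_commute[of xp x] distrib_left right_diff_distrib diff_divide_distrib)
  have "inner g (ag - (1 - \<alpha>) *\<^sub>R xa - \<alpha> *\<^sub>R z) = inner g (ag - v) + \<alpha> * inner g (x - z)"
    by (simp add: v_def inner_diff_right inner_add_right algebra_simps)
  then show ?thesis using 1 2 v(2) by linarith
qed

text \<open>Combines the quadratic upper bound at \<open>ag\<close> with the lower bounds at
  \<open>xa\<close> and \<open>z\<close>, weighted by \<open>1 - \<alpha>\<close> and
  \<open>\<alpha>\<close>. The constant \<open>\<mu>\<close> measures nonconvexity: it will be 0 for
  \<open>h\<close> and \<open>Lf\<close> for \<open>f\<close>.\<close>

lemma smooth_extrapolation_bound:
  fixes f :: "'a::real_inner \<Rightarrow> real"
  assumes df: "\<And>w. (f has_derivative (\<lambda>v. inner (gf w) v)) (at w)"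
    and lip: "L-lipschitz_on UNIV gf"
    and \<alpha>: "0 \<le> \<alpha>" "\<alpha> \<le> 1"
    and lower: "\<And>w. f md + inner (gf md) (w - md) \<le> f w + \<mu> / 2 * (norm (w - md))\<^sup>2"
  shows "f ag \<le> (1 - \<alpha>) * f xa + \<alpha> * f z + inner (gf md) (ag - (1 - \<alpha>) *\<^sub>R xa - \<alpha> *\<^sub>R z)
    + L / 2 * (norm (ag - md))\<^sup>2 + \<mu> / 2 * ((1 - \<alpha>) * (norm (xa - md))\<^sup>2 + \<alpha> * (norm (z - md))\<^sup>2)"
proof -
  have 1: "f ag \<le> f md + inner (gf md) (ag - md) + L / 2 * (norm (ag - md))\<^sup>2"
    using lipschitz_gradient_bound[OF df lip, of ag md md] by (simp add: power2_eq_square)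
  have 2: "(1 - \<alpha>) * (f md + inner (gf md) (xa - md))
      \<le> (1 - \<alpha>) * (f xa + \<mu> / 2 * (norm (xa - md))\<^sup>2)"
    using lower[of xa] \<alpha> by (intro mult_left_mono) auto
  have 3: "\<alpha> * (f md + inner (gf md) (z - md)) \<le> \<alpha> * (f z + \<mu> / 2 * (norm (z - md))\<^sup>2)"
    using lower[of z] \<alpha> by (intro mult_left_mono) auto
  have "f md + inner (gf md) (ag - md)
    = (1 - \<alpha>) * (f md + inner (gf md) (xa - md)) + \<alpha> * (f md + inner (gf md) (z - md))
      + inner (gf md) (ag - (1 - \<alpha>) *\<^sub>R xa - \<alpha> *\<^sub>R z)"
    by (simp add: inner_diff_right algebra_simps)
  moreover have "(1 - \<alpha>) * (f xa + \<mu> / 2 * (norm (xa - md))\<^sup>2)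
      + \<alpha> * (f z + \<mu> / 2 * (norm (z - md))\<^sup>2) = (1 - \<alpha>) * f xa + \<alpha> * f z
      + \<mu> / 2 * ((1 - \<alpha>) * (norm (xa - md))\<^sup>2 + \<alpha> * (norm (z - md))\<^sup>2)"
    by (simp add: field_simps)
  ultimately show ?thesis using 1 2 3 by linarith
qed

text \<open>Exhibits a factor \<open>\<alpha>\<close> in the nonconvexity error, so that for bounded
  iterates the error has the form that \<open>Gamma_telescope\<close> can sum.\<close>

lemma extrapolation_distance:
  fixes xa xp z :: "'a::real_inner"
  assumes "md = (1 - \<alpha>) *\<^sub>R xa + \<alpha> *\<^sub>R xp"
  shows "(1 - \<alpha>) * (norm (xa - md))\<^sup>2 + \<alpha> * (norm (z - md))\<^sup>2
    = \<alpha> * ((1 - \<alpha>) * (norm (z - xa))\<^sup>2 + \<alpha> * (norm (z - xp))\<^sup>2)"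
proof -
  define u v where "u = z - xa" and "v = z - xp"
  have 1: "xa - md = \<alpha> *\<^sub>R (v - u)" and 2: "z - md = (1 - \<alpha>) *\<^sub>R u + \<alpha> *\<^sub>R v"
    by (simp_all add: assms u_def v_def algebra_simps)
  show ?thesis
    unfolding 1 2 u_def[symmetric] v_def[symmetric] power2_norm_eq_inner
    by (simp add: inner_diff_left inner_diff_right inner_add_left inner_add_right
        inner_commute[of v u] algebra_simps)
qed

section \<open>The two convergence rates\<close>

theorem theorem2:
  fixes f h X :: "real ^ 'n \<Rightarrow> real"
    and gf gh :: "real ^ 'n \<Rightarrow> real ^ 'n"
    and D :: "(real ^ 'n) set"
    and Lf Lh M :: real
    and \<alpha> \<beta> lam :: "nat \<Rightarrow> real"
    and x xmd xag :: "nat \<Rightarrow> real ^ 'n"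
    and xs :: "real ^ 'n"
    and N :: nat
  assumes f_grad: "\<And>z. (f has_derivative (\<lambda>v. inner (gf z) v)) (at z)"
    and f_lip: "Lf-lipschitz_on UNIV gf"
    and h_convex: "convex_on UNIV h"
    and h_grad: "\<And>z. (h has_derivative (\<lambda>v. inner (gh z) v)) (at z)"
    and h_lip: "Lh-lipschitz_on UNIV gh"
    and X_pcc: "proper_closed_convex D X"
    and D_bounded: "bounded D"
    and M_bound: "\<And>c y z. c > 0 \<Longrightarrow> norm (prox D X z y c) \<le> M"
    and alpha1: "\<alpha> 1 = 1"
    and alpha_k: "\<And>k. k \<ge> 2 \<Longrightarrow> 0 < \<alpha> k \<and> \<alpha> k < 1"
    and beta_pos: "\<And>k. k \<ge> 1 \<Longrightarrow> \<beta> k > 0"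
    and lambda_pos: "\<And>k. k \<ge> 1 \<Longrightarrow> lam k > 0"
    and ag0: "xag 0 = x 0"
    and md_k: "\<And>k. k \<ge> 1 \<Longrightarrow> xmd k = (1 - \<alpha> k) *\<^sub>R xag (k - 1) + \<alpha> k *\<^sub>R x (k - 1)"
    and x_k: "\<And>k. k \<ge> 1 \<Longrightarrow> x k = prox D X (x (k - 1)) (gf (xmd k) + gh (xmd k)) (lam k)"
    and ag_k: "\<And>k. k \<ge> 1 \<Longrightarrow> xag k = prox D X (xmd k) (gf (xmd k) + gh (xmd k)) (\<beta> k)"
    and step_lo: "\<And>k. k \<ge> 1 \<Longrightarrow> \<alpha> k * lam k \<le> \<beta> k"
    and step_hi: "\<And>k. k \<ge> 1 \<Longrightarrow> (Lf + Lh) * \<beta> k < 1"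
    and mono: "\<And>k. k \<ge> 1 \<Longrightarrow>
       \<alpha> (k + 1) / (lam (k + 1) * Gamma \<alpha> (k + 1)) \<le> \<alpha> k / (lam k * Gamma \<alpha> k)"
    and xs_D: "xs \<in> D"
    and xs_opt: "\<And>z. z \<in> D \<Longrightarrow> f xs + h xs + X xs \<le> f z + h z + X z"
    and N1: "N \<ge> 1"
  shows "(Min ((\<lambda>k. (norm (grad_map D X (xmd k) (gf (xmd k) + gh (xmd k)) (\<beta> k)))\<^sup>2) ` {1..N})
           \<le> 2 * inverse (\<Sum>k = 1..N. \<beta> k * (1 - (Lf + Lh) * \<beta> k) / Gamma \<alpha> k)
             * ((norm (x 0 - xs))\<^sup>2 / (2 * lam 1) + Lf / Gamma \<alpha> N * ((norm xs)\<^sup>2 + 2 * M\<^sup>2)))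
      \<and> (Lf = 0 \<longrightarrow>
           (f (xag N) + h (xag N) + X (xag N)) - (f xs + h xs + X xs)
             \<le> Gamma \<alpha> N * (norm (x 0 - xs))\<^sup>2 / (2 * lam 1))"
proof -
  define \<Phi> where "\<Phi> z = f z + h z + X z" for z
  define g where "g k = gf (xmd k) + gh (xmd k)" for k
  define L where "L = Lf + Lh"
  define p where "p k = xag k - xmd k" for k
  define \<Delta> where "\<Delta> k = x k - x (k - 1)" for k
  define E where "E k = \<Phi> (xag k) - \<Phi> xs" for k
  define d where "d k = (norm (x k - xs))\<^sup>2" for k
  define w where "w k = \<beta> k * (1 - L * \<beta> k)" for k
  define G where "G k = norm (grad_map D X (xmd k) (gf (xmd k) + gh (xmd k)) (\<beta> k))" for k
  define s where "s = norm xs"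
  define \<mu> where "\<mu> = Min ((\<lambda>k. (G k)\<^sup>2) ` {1..N})"
  define m where "m = sqrt \<mu>"
  define \<tau> where "\<tau> = 1 / Gamma \<alpha> N - 1"
  have Lf: "0 \<le> Lf" using f_lip by (rule lipschitz_on_nonneg)
  have Lh: "0 \<le> Lh" using h_lip by (rule lipschitz_on_nonneg)
  have L: "0 \<le> L" "Lf \<le> L" using Lf Lh by (auto simp: L_def)
  have \<alpha>: "0 < \<alpha> k" "\<alpha> k \<le> 1" if "1 \<le> k" for k
    using alpha1 alpha_k[of k] that by (cases "k = 1"; force)+
  have \<Gamma>: "0 < Gamma \<alpha> k" for k
    using alpha_k by (intro Gamma_pos) auto
  have \<Psi>_grad: "((\<lambda>z. f z + h z) has_derivative (\<lambda>v. inner (gf z + gh z) v)) (at z)" for z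
    using has_derivative_add[OF f_grad h_grad, of z] by (simp add: inner_add_left)
  have \<Psi>_lip: "L-lipschitz_on UNIV (\<lambda>z. gf z + gh z)"
    unfolding L_def using f_lip h_lip by (rule lipschitz_on_add)
  \<comment> \<open>The step size 1 is arbitrary: the fixed point exhibits \<open>xs\<close> as a
    value of \<open>prox\<close>, to which \<open>M_bound\<close> applies.\<close>
  have "prox D X xs (gf xs + gh xs) 1 = xs"
    by (rule minimizer_prox_fixed[OF X_pcc D_bounded _ xs_D \<Psi>_grad \<Psi>_lip])
       (use xs_opt in auto)
  then have s: "0 \<le> s" "s \<le> M"
    using M_bound[of 1 xs "gf xs + gh xs"] by (auto simp: s_def)
  have xag_D: "xag k \<in> D" "norm (xag k) \<le> M" if "1 \<le> k" for k
    unfolding ag_k[OF that] using M_bound beta_pos[OF that] prox_in_domain_minimal(1)[OF X_pcc D_bounded]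
    by auto
  have x_M: "norm (x k) \<le> M" if "1 \<le> k" for k
    unfolding x_k[OF that] using M_bound lambda_pos[OF that] by auto
  have dist_xs: "norm (xs - z) \<le> M + s" if "norm z \<le> M" for z
    using norm_triangle_ineq4[of xs z] that by (simp add: s_def)
  have E_nonneg: "0 \<le> E k" if "1 \<le> k" for k
    using xs_opt[OF xag_D(1)[OF that]] by (simp add: E_def \<Phi>_def)
  have G_p: "\<beta> k * G k = norm (p k)" if "1 \<le> k" for k
    using beta_pos[OF that] unfolding G_def grad_map_def ag_k[OF that, symmetric]
    by (simp add: p_def norm_minus_commute)
  have "0 \<le> \<mu>" unfolding \<mu>_def using N1 by (subst Min_ge_iff) auto
  then have m: "0 \<le> m" "m\<^sup>2 = \<mu>" by (auto simp: m_def)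
  have m_le: "m \<le> G k" if "1 \<le> k" "k \<le> N" for k
  proof -
    have "\<mu> \<le> (G k)\<^sup>2" unfolding \<mu>_def using that by (intro Min_le) auto
    then show ?thesis unfolding m_def by (intro real_le_lsqrt) (auto simp: G_def)
  qed
  have pair: "inner (g k) (xag k - (1 - \<alpha> k) *\<^sub>R xag (k - 1) - \<alpha> k *\<^sub>R xs) + X (xag k)
      - (1 - \<alpha> k) * X (xag (k - 1)) - \<alpha> k * X xs
      + (norm (p k))\<^sup>2 / \<beta> k - \<alpha> k / \<beta> k * inner (p k) (\<Delta> k)
    \<le> \<alpha> k / (2 * lam k) * (d (k - 1) - d k - (norm (\<Delta> k))\<^sup>2)" if k: "1 \<le> k" for k
  proof -
    have "xag (k - 1) \<in> D \<or> \<alpha> k = 1"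
      using alpha1 xag_D(1)[of "k - 1"] k by (cases "k = 1") auto
    from prox_pair_ineq[OF X_pcc D_bounded xs_D \<alpha>[OF k] beta_pos[OF k] lambda_pos[OF k] this
        md_k[OF k] x_k[OF k] ag_k[OF k]]
    show ?thesis unfolding g_def p_def \<Delta>_def d_def .
  qed
  have h_bound: "h (xag k) \<le> (1 - \<alpha> k) * h (xag (k - 1)) + \<alpha> k * h xs
      + inner (gh (xmd k)) (xag k - (1 - \<alpha> k) *\<^sub>R xag (k - 1) - \<alpha> k *\<^sub>R xs)
      + Lh / 2 * (norm (p k))\<^sup>2" if k: "1 \<le> k" for k
    using smooth_extrapolation_bound[OF h_grad h_lip, of "\<alpha> k" "xmd k" 0 "xag k" "xag (k - 1)" xs]
      \<alpha>[OF k] convex_gradient_ineq[OF h_convex h_grad] by (simp add: p_def)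
  \<comment> \<open>From \<open>k = 2\<close> on, \<open>xag (k - 1)\<close> and
    \<open>x (k - 1)\<close> are prox points and hence bounded by \<open>M\<close>, which controls
    the nonconvexity error. The bracket on the left is the quantity estimated in
    \<open>quadratic_lower_bounds\<close>.\<close>
  have step: "E k + ((2 - L * \<beta> k) * \<beta> k * (G k)\<^sup>2 / 2 - \<alpha> k * G k * norm (\<Delta> k)
        + \<alpha> k / (2 * lam k) * (norm (\<Delta> k))\<^sup>2)
      \<le> (1 - \<alpha> k) * E (k - 1) + \<alpha> k / (2 * lam k) * (d (k - 1) - d k)
        + \<alpha> k * (Lf * (M + s)\<^sup>2 / 2)" if k: "2 \<le> k" for k
  proof -
    have k1: "1 \<le> k" "1 \<le> k - 1" using k by auto
    have \<beta>: "0 < \<beta> k" using beta_pos k1 by simp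
    have "f (xmd k) + inner (gf (xmd k)) (z - xmd k) \<le> f z + Lf / 2 * (norm (z - xmd k))\<^sup>2" for z
      using lipschitz_gradient_bound[OF f_grad f_lip, of "xmd k" z "xmd k"]
      by (simp add: norm_minus_commute[of "xmd k"] power2_eq_square inner_diff_right)
    from smooth_extrapolation_bound[OF f_grad f_lip _ _ this, of "\<alpha> k" "xag k" "xag (k - 1)" xs]
    have f_bound: "f (xag k) \<le> (1 - \<alpha> k) * f (xag (k - 1)) + \<alpha> k * f xs
        + inner (gf (xmd k)) (xag k - (1 - \<alpha> k) *\<^sub>R xag (k - 1) - \<alpha> k *\<^sub>R xs)
        + Lf / 2 * (norm (p k))\<^sup>2 + Lf / 2 * ((1 - \<alpha> k) * (norm (xag (k - 1) - xmd k))\<^sup>2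
        + \<alpha> k * (norm (xs - xmd k))\<^sup>2)"
      using \<alpha>[OF k1(1)] by (simp add: p_def)
    have "(1 - \<alpha> k) * (norm (xs - xag (k - 1)))\<^sup>2 + \<alpha> k * (norm (xs - x (k - 1)))\<^sup>2
        \<le> (1 - \<alpha> k) * (M + s)\<^sup>2 + \<alpha> k * (M + s)\<^sup>2"
      using \<alpha>[OF k1(1)] dist_xs xag_D(2) x_M k1
      by (intro add_mono mult_left_mono power_mono) auto
    also have "\<dots> = (M + s)\<^sup>2" by (simp add: left_diff_distrib)
    finally have "\<alpha> k * ((1 - \<alpha> k) * (norm (xs - xag (k - 1)))\<^sup>2
        + \<alpha> k * (norm (xs - x (k - 1)))\<^sup>2) \<le> \<alpha> k * (M + s)\<^sup>2"
      using \<alpha>[OF k1(1)] by (intro mult_left_mono) auto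
    then have "(1 - \<alpha> k) * (norm (xag (k - 1) - xmd k))\<^sup>2 + \<alpha> k * (norm (xs - xmd k))\<^sup>2
        \<le> \<alpha> k * (M + s)\<^sup>2"
      unfolding extrapolation_distance[OF md_k[OF k1(1)]] .
    from mult_left_mono[OF this, of "Lf / 2"] Lf
    have err: "Lf / 2 * ((1 - \<alpha> k) * (norm (xag (k - 1) - xmd k))\<^sup>2
        + \<alpha> k * (norm (xs - xmd k))\<^sup>2) \<le> \<alpha> k * (Lf * (M + s)\<^sup>2 / 2)"
      by (simp add: mult_ac)
    have "inner (p k) (\<Delta> k) \<le> norm (p k) * norm (\<Delta> k)" by (rule norm_cauchy_schwarz)
    then have "\<alpha> k / \<beta> k * inner (p k) (\<Delta> k) \<le> \<alpha> k / \<beta> k * (norm (p k) * norm (\<Delta> k))"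
      using \<alpha>[OF k1(1)] \<beta> by (intro mult_left_mono) auto
    also have "\<dots> = \<alpha> k * G k * norm (\<Delta> k)"
      unfolding G_p[OF k1(1), symmetric] using \<beta> by simp
    finally have cs: "\<alpha> k / \<beta> k * inner (p k) (\<Delta> k) \<le> \<alpha> k * G k * norm (\<Delta> k)" .
    have quad: "(2 - L * \<beta> k) * \<beta> k * (G k)\<^sup>2 / 2
        = (norm (p k))\<^sup>2 / \<beta> k - Lf / 2 * (norm (p k))\<^sup>2 - Lh / 2 * (norm (p k))\<^sup>2"
      unfolding G_p[OF k1(1), symmetric] L_def using \<beta> by (simp add: power2_eq_square field_simps)
    have "(1 - \<alpha> k) * E (k - 1) = (1 - \<alpha> k) * f (xag (k - 1)) + (1 - \<alpha> k) * h (xag (k - 1))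
        + (1 - \<alpha> k) * X (xag (k - 1)) - (f xs + h xs + X xs) + \<alpha> k * f xs + \<alpha> k * h xs + \<alpha> k * X xs"
      by (simp add: E_def \<Phi>_def algebra_simps)
    moreover have "\<alpha> k / (2 * lam k) * (d (k - 1) - d k - (norm (\<Delta> k))\<^sup>2)
        = \<alpha> k / (2 * lam k) * (d (k - 1) - d k) - \<alpha> k / (2 * lam k) * (norm (\<Delta> k))\<^sup>2"
      by (simp only: right_diff_distrib)
    ultimately show ?thesis
      using pair[OF k1(1)] h_bound[OF k1(1)] f_bound err cs quad
      unfolding E_def[of k] \<Phi>_def g_def inner_add_left by linarith
  qed
  define a b e where "a = norm (x 0 - xs)" and "b = norm (p 1)" and "e = norm (xag 1 - xs)"
  define \<gamma> where "\<gamma> = w 1 * (G 1)\<^sup>2 / 2"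
  define V where "V = E 1 + d 1 / (2 * lam 1)"
  have \<beta>1: "0 < \<beta> 1" and l1: "0 < lam 1" "lam 1 \<le> \<beta> 1"
    using beta_pos lambda_pos step_lo[of 1] alpha1 by auto
  have xmd1: "xmd 1 = x 0" "xmd (Suc 0) = x 0" using md_k[of 1] alpha1 by simp_all
  \<comment> \<open>Here \<open>f\<close> is compared at \<open>xag 1\<close> and \<open>xs\<close>
    directly, with the gradient at \<open>x 0\<close>. The cross term is split by the
    arithmetic-geometric inequality using \<open>lam 1 \<le> \<beta> 1\<close>, and the
    \<open>Lh\<close> terms cancel against \<open>\<gamma>\<close>.\<close>
  have first: "V + \<gamma> \<le> a\<^sup>2 / (2 * lam 1) + Lf * (e * (a + b) / 2 - b\<^sup>2 / 2)"
  proof -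
    have "f (xag 1) - f xs - inner (gf (x 0)) (xag 1 - xs) \<le> Lf * e * (b + a) / 2"
      using lipschitz_gradient_bound[OF f_grad f_lip, of "xag 1" xs "x 0"]
      by (simp add: e_def b_def a_def p_def xmd1 norm_minus_commute[of xs])
    moreover have "h (xag 1) \<le> h xs + inner (gh (x 0)) (xag 1 - xs) + Lh / 2 * b\<^sup>2"
      using h_bound[of 1] alpha1 by (simp add: xmd1 b_def)
    moreover have "inner (gf (x 0)) (xag 1 - xs) + inner (gh (x 0)) (xag 1 - xs) + X (xag 1) - X xs
        + b\<^sup>2 / \<beta> 1 - inner (p 1) (\<Delta> 1) / \<beta> 1
        \<le> (a\<^sup>2 - d 1 - (norm (\<Delta> 1))\<^sup>2) / (2 * lam 1)"
      using pair[of 1] alpha1 by (simp add: g_def xmd1 b_def a_def d_def inner_add_left)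
    moreover have "inner (p 1) (\<Delta> 1) / \<beta> 1 \<le> b\<^sup>2 / (2 * \<beta> 1) + (norm (\<Delta> 1))\<^sup>2 / (2 * lam 1)"
    proof -
      have "inner (p 1) (\<Delta> 1) \<le> (b\<^sup>2 + (norm (\<Delta> 1))\<^sup>2) / 2"
        using norm_cauchy_schwarz[of "p 1" "\<Delta> 1"] sum_squares_bound[of b "norm (\<Delta> 1)"]
        by (simp add: b_def)
      then have "inner (p 1) (\<Delta> 1) / \<beta> 1 \<le> (b\<^sup>2 + (norm (\<Delta> 1))\<^sup>2) / 2 / \<beta> 1"
        using \<beta>1 by (intro divide_right_mono) auto
      also have "\<dots> = b\<^sup>2 / (2 * \<beta> 1) + (norm (\<Delta> 1))\<^sup>2 / (2 * \<beta> 1)"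
        by (simp add: add_divide_distrib)
      also have "\<dots> \<le> b\<^sup>2 / (2 * \<beta> 1) + (norm (\<Delta> 1))\<^sup>2 / (2 * lam 1)"
        using l1 by (intro add_left_mono divide_left_mono) auto
      finally show ?thesis .
    qed
    moreover have "\<gamma> = b\<^sup>2 / (2 * \<beta> 1) - Lf * b\<^sup>2 / 2 - Lh / 2 * b\<^sup>2"
      unfolding \<gamma>_def w_def L_def b_def G_p[OF order_refl, symmetric] using \<beta>1
      by (simp add: power2_eq_square field_simps)
    moreover have "b\<^sup>2 / \<beta> 1 = 2 * (b\<^sup>2 / (2 * \<beta> 1))" by simp
    moreover have "Lf * (e * (a + b) / 2 - b\<^sup>2 / 2) = Lf * e * (b + a) / 2 - Lf * b\<^sup>2 / 2"
      by (simp add: algebra_simps)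
    ultimately show ?thesis
      unfolding V_def E_def \<Phi>_def diff_divide_distrib by linarith
  qed
  \<comment> \<open>Kept general in \<open>c\<close>, since both lower bounds are to be
    summed.\<close>
  have telescope: "(\<Sum>k = 2..N. c k / Gamma \<alpha> k) + E N / Gamma \<alpha> N
      \<le> V + Lf * \<tau> * (M + s)\<^sup>2 / 2"
    if c: "\<And>k. 2 \<le> k \<Longrightarrow> k \<le> N \<Longrightarrow> c k \<le> (2 - L * \<beta> k) * \<beta> k * (G k)\<^sup>2 / 2
        - \<alpha> k * G k * norm (\<Delta> k) + \<alpha> k / (2 * lam k) * (norm (\<Delta> k))\<^sup>2" for c
  proof -
    have "E N / Gamma \<alpha> N + (\<Sum>k = 2..N. c k / Gamma \<alpha> k) + \<alpha> N / (lam N * Gamma \<alpha> N) * d N / 2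
      \<le> E 1 + d 1 / (2 * lam 1) + (1 / Gamma \<alpha> N - 1) * (Lf * (M + s)\<^sup>2 / 2)"
    proof (rule Gamma_telescope[OF N1 alpha1 _ mono])
      fix k assume k: "1 \<le> k" "Suc k \<le> N"
      show "E (Suc k) + c (Suc k) \<le> (1 - \<alpha> (Suc k)) * E k + \<alpha> (Suc k) / (2 * lam (Suc k))
          * (d k - d (Suc k)) + \<alpha> (Suc k) * (Lf * (M + s)\<^sup>2 / 2)"
        using step[of "Suc k"] c[of "Suc k"] k by simp
    qed (use alpha_k in \<open>auto simp: d_def\<close>)
    moreover have "0 \<le> \<alpha> N / (lam N * Gamma \<alpha> N) * d N / 2"
      using \<alpha>(1)[OF N1] lambda_pos[OF N1] \<Gamma>[of N] by (simp add: d_def)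
    ultimately show ?thesis by (simp add: V_def \<tau>_def mult_ac)
  qed
  have \<Delta>_le: "norm (\<Delta> k) \<le> 2 * M" if "2 \<le> k" for k
  proof -
    have "norm (x k) \<le> M" "norm (x (k - 1)) \<le> M" using that by (auto intro: x_M)
    then show ?thesis
      using norm_triangle_ineq4[of "x k" "x (k - 1)"] unfolding \<Delta>_def by linarith
  qed
  have bounds: "w k * m\<^sup>2 / 2 \<le> (2 - L * \<beta> k) * \<beta> k * (G k)\<^sup>2 / 2
        - \<alpha> k * G k * norm (\<Delta> k) + \<alpha> k / (2 * lam k) * (norm (\<Delta> k))\<^sup>2"
      "w k * m\<^sup>2 - \<alpha> k * (2 * M) * m \<le> (2 - L * \<beta> k) * \<beta> k * (G k)\<^sup>2 / 2
        - \<alpha> k * G k * norm (\<Delta> k) + \<alpha> k / (2 * lam k) * (norm (\<Delta> k))\<^sup>2"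
    if "2 \<le> k" "k \<le> N" for k
    unfolding w_def
    using that \<alpha>[of k] lambda_pos[of k] step_lo[of k] step_hi[of k] L(1) m m_le[of k] \<Delta>_le[of k]
    by (intro quadratic_lower_bounds; simp add: L_def)+
  define q where "q = (\<Sum>k = 2..N. w k * m\<^sup>2 / 2 / Gamma \<alpha> k)"
  have \<tau>_sum: "(\<Sum>k = 2..N. \<alpha> k / Gamma \<alpha> k) = \<tau>"
    unfolding \<tau>_def using N1
  proof (induction N rule: nat_induct_at_least)
    case (Suc n)
    have "\<alpha> (Suc n) / Gamma \<alpha> (Suc n) = 1 / Gamma \<alpha> (Suc n) - 1 / Gamma \<alpha> n"
      using Suc.hyps \<Gamma>[of n] \<Gamma>[of "Suc n"] by (simp add: field_simps)
    then show ?case using Suc by (simp del: Gamma.simps)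
  qed simp
  have \<tau>: "0 \<le> \<tau>"
    unfolding \<tau>_sum[symmetric] using \<alpha> \<Gamma> by (intro sum_nonneg divide_nonneg_nonneg) (auto intro: less_imp_le)
  have std: "q + E N / Gamma \<alpha> N \<le> V + Lf * \<tau> * (M + s)\<^sup>2 / 2"
    unfolding q_def by (rule telescope) (rule bounds)
  \<comment> \<open>The second bound lacks the factor 1/2 in \<open>q\<close>, hence
    \<open>2 * q\<close>; its linear terms add up to a multiple of \<open>\<tau>\<close>.\<close>
  have "(\<Sum>k = 2..N. (w k * m\<^sup>2 - \<alpha> k * (2 * M) * m) / Gamma \<alpha> k) = 2 * q - 2 * M * \<tau> * m"
    unfolding q_def \<tau>_sum[symmetric] sum_distrib_left sum_distrib_right sum_subtractf[symmetric]
    by (rule sum.cong) (simp_all add: diff_divide_distrib)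
  then have alt: "2 * q - 2 * M * \<tau> * m + E N / Gamma \<alpha> N \<le> V + Lf * \<tau> * (M + s)\<^sup>2 / 2"
    using telescope[of "\<lambda>k. w k * m\<^sup>2 - \<alpha> k * (2 * M) * m"] bounds(2) by simp
  have E_N: "0 \<le> E N / Gamma \<alpha> N"
    using E_nonneg[OF N1] \<Gamma>[of N] by simp
  have w_pos: "0 < w k" if "1 \<le> k" for k
    using beta_pos[OF that] step_hi[OF that] by (simp add: w_def L_def)
  have total: "q + \<gamma> \<le> a\<^sup>2 / (2 * lam 1) + Lf * (1 + \<tau>) * (s\<^sup>2 + 2 * M\<^sup>2)"
  proof (rule weighted_sum_bound[OF s _ _ _ _ _ l1 Lf \<tau> _ _ first])
    show "e \<le> M + s" using dist_xs[OF xag_D(2), of 1] by (simp add: e_def norm_minus_commute)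
    show "a \<le> b + e"
      using norm_triangle_ineq[of "x 0 - xag 1" "xag 1 - xs"]
      by (simp add: a_def b_def e_def p_def xmd1 norm_minus_commute[of "x 0"])
    show "\<beta> 1 * m \<le> b"
      unfolding b_def G_p[OF order_refl, symmetric] using m_le[of 1] N1 \<beta>1 by simp
    have "\<gamma> = (1 - L * \<beta> 1) * b\<^sup>2 / (2 * \<beta> 1)"
      unfolding \<gamma>_def w_def b_def G_p[OF order_refl, symmetric] using \<beta>1
      by (simp add: power2_eq_square field_simps)
    also have "\<dots> \<le> (1 - Lf * \<beta> 1) * b\<^sup>2 / (2 * \<beta> 1)"
      using L \<beta>1 by (intro divide_right_mono mult_right_mono) auto
    finally show "\<gamma> \<le> (1 - Lf * \<beta> 1) * b\<^sup>2 / (2 * \<beta> 1)" .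
  qed (use std alt E_N in \<open>auto simp: a_def b_def e_def\<close>)
  define W where "W = (\<Sum>k = 1..N. w k / Gamma \<alpha> k)"
  have W_pos: "0 < W"
    unfolding W_def using N1 w_pos \<Gamma> by (intro sum_pos) auto
  have "q = (\<Sum>k = 2..N. w k / Gamma \<alpha> k) * (\<mu> / 2)"
    unfolding q_def m(2) sum_distrib_right by (rule sum.cong) (simp_all add: mult_ac)
  \<comment> \<open>The first weight is undivided because
    \<open>Gamma \<alpha> 1 = 1\<close>.\<close>
  moreover have "W = w 1 + (\<Sum>k = 2..N. w k / Gamma \<alpha> k)"
    unfolding W_def sum.atLeast_Suc_atMost[OF N1] by (simp add: numeral_2_eq_2)
  ultimately have "W * \<mu> / 2 = w 1 * m\<^sup>2 / 2 + q"
    by (simp add: m(2) distrib_right add_divide_distrib)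
  also have "w 1 * m\<^sup>2 / 2 \<le> \<gamma>"
    unfolding \<gamma>_def using w_pos[of 1] m m_le[of 1] N1
    by (intro divide_right_mono mult_left_mono power_mono) auto
  finally have "W * \<mu> / 2 \<le> a\<^sup>2 / (2 * lam 1) + Lf * (1 + \<tau>) * (s\<^sup>2 + 2 * M\<^sup>2)"
    using total by simp
  \<comment> \<open>By definition \<open>1 + \<tau> = 1 / Gamma \<alpha> N\<close>.\<close>
  then have min_bound: "\<mu> \<le> 2 * inverse W * (a\<^sup>2 / (2 * lam 1)
      + Lf / Gamma \<alpha> N * (s\<^sup>2 + 2 * M\<^sup>2))"
    using W_pos by (simp add: \<tau>_def field_simps)
  \<comment> \<open>With \<open>Lf = 0\<close> the error terms vanish from \<open>std\<close> and
    \<open>first\<close>; dropping the nonnegative \<open>q\<close> and \<open>\<gamma>\<close>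
    leaves only the gap in function value.\<close>
  have "E N \<le> Gamma \<alpha> N * a\<^sup>2 / (2 * lam 1)" if "Lf = 0"
  proof -
    have "0 \<le> q" unfolding q_def using w_pos \<Gamma>
      by (intro sum_nonneg divide_nonneg_pos mult_nonneg_nonneg) (auto intro: less_imp_le)
    moreover have "0 \<le> \<gamma>" unfolding \<gamma>_def using w_pos[of 1] by simp
    ultimately have "E N / Gamma \<alpha> N \<le> a\<^sup>2 / (2 * lam 1)"
      using std first that by simp
    then show ?thesis using \<Gamma>[of N] by (simp add: field_simps)
  qed
  with min_bound show ?thesis
    unfolding \<mu>_def G_def W_def w_def L_def a_def s_def E_def \<Phi>_def by simp
qed

end
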